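(* Let $H$ be a nontrivial connected topological group, let $H_{d}$ be the same group $H$ equipped with the discrete topology, and let $G=H\times H_{d}$ be the product topological group. Then the identity component of $G$ is $G_{0}=H\times\{e\}$, where $e$ is the identity element of $H_{d}$, and $G_{0}$ is not a characteristic subgroup of $G$. In particular, the identity component of a topological group is not always a characteristic subgroup.
   Context: The identity component of a topological group $G$ is the connected component of $G$ containing the identity element. A subgroup $N$ of $G$ is characteristic if $\varphi(N)\subseteq N$ for every automorphism $\varphi$ of the abstract group $G$ (not necessarily continuous). *)

theory Defs
  imports "HOL-Analysis.Analysis" "HOL-Algebra.Group"
begin

(* No separation axiom is imposed on a topological group. *)
locale topological_group = group G for G (structure) +
  fixes T :: "'a topology"
  assumes topspace_eq_carrier: "topspace T = carrier G"
    and continuous_mult: "continuous_map (prod_topology T T) T (\<lambda>(x, y). x \<otimes> y)"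
    and continuous_inv: "continuous_map T T (\<lambda>x. inv x)"

definition identity_component :: "('a, 'b) monoid_scheme \<Rightarrow> 'a topology \<Rightarrow> 'a set" where
  "identity_component G T = connected_component_of_set T \<one>\<^bsub>G\<^esub>"

(* Elements of iso G G are only required to be bijective homomorphisms on carrier G: these are
   the automorphisms of the abstract group, with arbitrary values off the carrier. *)
definition characteristic_subgroup :: "'a set \<Rightarrow> ('a, 'b) monoid_scheme \<Rightarrow> bool" where
  "characteristic_subgroup N G \<longleftrightarrow> subgroup N G \<and> (\<forall>\<phi>\<in>iso G G. \<phi> ` N \<subseteq> N)"

end

theory Submission
  imports Defs
begin

text \<open>
  Connected components of a product are products of connected components, and in a discrete space
  the components are points; hence the identity component of \<open>H \<times> H\<^sub>d\<close> is \<open>H \<times> {e}\<close> when \<open>H\<close> is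
  connected. As an abstract group, however, \<open>H \<times> H\<^sub>d\<close> is just \<open>H \<times> H\<close>, and the exchange of the two
  factors is an automorphism that ignores the topology. It carries \<open>H \<times> {e}\<close> to \<open>{e} \<times> H\<close>, which is
  not contained in \<open>H \<times> {e}\<close> once \<open>H\<close> has an element other than \<open>e\<close>. The additive group of the
  reals is a concrete choice of \<open>H\<close>, so the identity component need not be characteristic.
\<close>

text \<open>
  Multiplication in the product regroups \<open>((a, b), (a', b'))\<close> as \<open>((a, a'), (b, b'))\<close>, so continuity
  is checked one factor at a time.
\<close>

lemma topological_group_DirProd:
  assumes "topological_group G T" "topological_group K U"
  shows "topological_group (G \<times>\<times> K) (prod_topology T U)"
proof -
  interpret G: topological_group G T by fact
  interpret K: topological_group K U by fact
  interpret GK: group "G \<times>\<times> K"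
    by (intro DirProd_group G.is_group K.is_group)
  let ?P = "prod_topology T U"
  show ?thesis
  proof unfold_locales
    show "topspace ?P = carrier (G \<times>\<times> K)"
      by (simp add: G.topspace_eq_carrier K.topspace_eq_carrier)
  next
    let ?Q = "prod_topology ?P ?P"
    have "continuous_map ?Q T (\<lambda>p. fst (fst p))" "continuous_map ?Q T (\<lambda>p. fst (snd p))"
      "continuous_map ?Q U (\<lambda>p. snd (fst p))" "continuous_map ?Q U (\<lambda>p. snd (snd p))"
      using continuous_map_compose[OF continuous_map_fst continuous_map_fst]
        continuous_map_compose[OF continuous_map_snd continuous_map_fst]
        continuous_map_compose[OF continuous_map_fst continuous_map_snd]
        continuous_map_compose[OF continuous_map_snd continuous_map_snd]
      by (force simp: o_def)+
    then have TT: "continuous_map ?Q (prod_topology T T) (\<lambda>p. (fst (fst p), fst (snd p)))"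
      and UU: "continuous_map ?Q (prod_topology U U) (\<lambda>p. (snd (fst p), snd (snd p)))"
      by (simp_all add: continuous_map_paired)
    have "continuous_map ?Q ?P
        (\<lambda>p. (fst (fst p) \<otimes>\<^bsub>G\<^esub> fst (snd p), snd (fst p) \<otimes>\<^bsub>K\<^esub> snd (snd p)))"
      using continuous_map_compose[OF TT G.continuous_mult]
        continuous_map_compose[OF UU K.continuous_mult]
      by (simp add: continuous_map_paired o_def)
    then show "continuous_map ?Q ?P (\<lambda>(x, y). x \<otimes>\<^bsub>G \<times>\<times> K\<^esub> y)"
      by (simp add: mult_DirProd' case_prod_unfold)
  next
    have "continuous_map ?P ?P (\<lambda>p. (inv\<^bsub>G\<^esub> fst p, inv\<^bsub>K\<^esub> snd p))"
      using continuous_map_compose[OF continuous_map_fst[of T U] G.continuous_inv]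
        continuous_map_compose[OF continuous_map_snd[of T U] K.continuous_inv]
      by (simp add: o_def continuous_map_paired)
    then show "continuous_map ?P ?P (\<lambda>p. inv\<^bsub>G \<times>\<times> K\<^esub> p)"
      by (rule continuous_map_eq)
        (auto simp: G.topspace_eq_carrier K.topspace_eq_carrier G.is_group K.is_group)
  qed
qed

lemma topological_group_discrete:
  assumes "group G"
  shows "topological_group G (discrete_topology (carrier G))"
proof -
  interpret group G by fact
  show ?thesis
    by unfold_locales (auto simp flip: prod_topology_discrete_topology)
qed

text \<open>
  Both projections map a connected set to a connected set, and a product of connected sets is
  connected. When a coordinate lies outside its space, both sides are empty.
\<close>

lemma connected_component_of_prod_topology:
  "connected_component_of_set (prod_topology X Y) (x, y) =
     connected_component_of_set X x \<times> connected_component_of_set Y y"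
proof
  show "connected_component_of_set (prod_topology X Y) (x, y) \<subseteq>
      connected_component_of_set X x \<times> connected_component_of_set Y y"
    using connected_component_of_continuous_image[OF continuous_map_fst, of X Y "(x, y)"]
      connected_component_of_continuous_image[OF continuous_map_snd, of X Y "(x, y)"]
    by fastforce
next
  show "connected_component_of_set X x \<times> connected_component_of_set Y y \<subseteq>
      connected_component_of_set (prod_topology X Y) (x, y)"
  proof (cases "x \<in> topspace X \<and> y \<in> topspace Y")
    case True
    then show ?thesis
      by (intro connected_component_of_maximal)
        (auto simp: connectedin_Times connectedin_connected_component_of connected_component_of_refl)
  next
    case False
    then show ?thesis
      by (metis Sigma_empty1 Times_empty connected_component_of_eq_empty empty_subsetI)
  qed
qed

lemma identity_component_times_discrete:
  assumes "topological_group H T" "connected_space T" "group K"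
  shows "identity_component (H \<times>\<times> K) (prod_topology T (discrete_topology (carrier K))) =
    carrier H \<times> {\<one>\<^bsub>K\<^esub>}"
proof -
  interpret H: topological_group H T by fact
  interpret K: group K by fact
  have "connected_component_of_set T \<one>\<^bsub>H\<^esub> = carrier H"
    using assms(2) H.one_closed
    unfolding connected_space_connected_component_set H.topspace_eq_carrier by blast
  then show ?thesis
    by (simp add: identity_component_def connected_component_of_prod_topology
        connected_component_of_discrete_topology)
qed

text \<open>
  The witness is the exchange of the two factors. It is an automorphism of the abstract group only:
  it fails to be continuous when one factor carries a strictly finer topology than the other.
\<close>

lemma not_characteristic_subgroup_factor:
  assumes "group H" "carrier H \<noteq> {\<one>\<^bsub>H\<^esub>}"
  shows "\<not> characteristic_subgroup (carrier H \<times> {\<one>\<^bsub>H\<^esub>}) (H \<times>\<times> H)"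
proof
  interpret group H by fact
  assume "characteristic_subgroup (carrier H \<times> {\<one>\<^bsub>H\<^esub>}) (H \<times>\<times> H)"
  then have swap: "(\<lambda>(x, y). (y, x)) ` (carrier H \<times> {\<one>\<^bsub>H\<^esub>}) \<subseteq> carrier H \<times> {\<one>\<^bsub>H\<^esub>}"
    using DirProd_commute_iso_set[of H H] unfolding characteristic_subgroup_def by blast
  obtain h where "h \<in> carrier H" "h \<noteq> \<one>\<^bsub>H\<^esub>"
    using assms(2) one_closed by blast
  with swap show False by auto
qed

lemma topological_group_real:
  "topological_group \<lparr>carrier = UNIV, mult = (+), one = 0 :: real\<rparr> euclidean"
proof -
  let ?R = "\<lparr>carrier = UNIV, mult = (+), one = 0 :: real\<rparr>"
  interpret group ?R
  proof (rule groupI)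
    fix x :: real
    have "- x \<otimes>\<^bsub>?R\<^esub> x = \<one>\<^bsub>?R\<^esub>"
      by simp
    then show "\<exists>y\<in>carrier ?R. y \<otimes>\<^bsub>?R\<^esub> x = \<one>\<^bsub>?R\<^esub>"
      by (metis UNIV_I partial_object.select_convs(1))
  qed auto
  have inv: "inv\<^bsub>?R\<^esub> x = - x" for x
    by (rule inv_equality) auto
  show ?thesis
  proof unfold_locales
    show "continuous_map (prod_topology euclidean euclidean) euclidean (\<lambda>(x, y). x \<otimes>\<^bsub>?R\<^esub> y)"
      by (simp add: case_prod_unfold continuous_on_add continuous_on_fst continuous_on_snd
          continuous_on_id)
    show "continuous_map euclidean euclidean (\<lambda>x. inv\<^bsub>?R\<^esub> x)"
      by (simp add: inv continuous_on_minus continuous_on_id)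
  qed simp
qed

theorem mainTheorem6:
  shows "(\<forall>(H :: ('a, 'b) monoid_scheme) (T :: 'a topology).
            topological_group H T \<and> connected_space T \<and> carrier H \<noteq> {\<one>\<^bsub>H\<^esub>} \<longrightarrow>
            (let G = H \<times>\<times> H;
                 TG = prod_topology T (discrete_topology (carrier H));
                 G\<^sub>0 = identity_component G TG
             in topological_group G TG \<and>
                G\<^sub>0 = carrier H \<times> {\<one>\<^bsub>H\<^esub>} \<and>
                subgroup G\<^sub>0 G \<and>
                \<not> characteristic_subgroup G\<^sub>0 G)) \<and>
         \<not> (\<forall>(G :: (real \<times> real) monoid) (T :: (real \<times> real) topology).
              topological_group G T \<longrightarrow> characteristic_subgroup (identity_component G T) G)"
proof (intro conjI allI impI)
  fix H :: "('a, 'b) monoid_scheme" and T :: "'a topology"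
  assume *: "topological_group H T \<and> connected_space T \<and> carrier H \<noteq> {\<one>\<^bsub>H\<^esub>}"
  then interpret H: topological_group H T by blast
  have "subgroup (carrier H \<times> {\<one>\<^bsub>H\<^esub>}) (H \<times>\<times> H)"
    by (intro DirProd_subgroups H.is_group H.subgroup_self H.triv_subgroup)
  with * show "let G = H \<times>\<times> H;
                 TG = prod_topology T (discrete_topology (carrier H));
                 G\<^sub>0 = identity_component G TG
             in topological_group G TG \<and>
                G\<^sub>0 = carrier H \<times> {\<one>\<^bsub>H\<^esub>} \<and>
                subgroup G\<^sub>0 G \<and>
                \<not> characteristic_subgroup G\<^sub>0 G"
    by (simp add: Let_def identity_component_times_discrete H.is_group
        not_characteristic_subgroup_factor topological_group_DirProd topological_group_discrete)
next
  let ?R = "\<lparr>carrier = UNIV, mult = (+), one = 0 :: real\<rparr>"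
  let ?T = "prod_topology euclidean (discrete_topology (carrier ?R))"
  interpret R: topological_group ?R euclidean
    by (rule topological_group_real)
  have "carrier ?R \<noteq> {\<one>\<^bsub>?R\<^esub>}"
    by (metis UNIV_I monoid.select_convs(2) partial_object.select_convs(1) singletonD zero_neq_one)
  moreover have "connected_space (euclidean :: real topology)"
    using connected_UNIV connectedin_iff_connected[of UNIV] by (metis connectedin_topspace topspace_euclidean)
  ultimately have "\<not> characteristic_subgroup (identity_component (?R \<times>\<times> ?R) ?T) (?R \<times>\<times> ?R)"
    using not_characteristic_subgroup_factor[OF R.is_group]
      identity_component_times_discrete[OF topological_group_real _ R.is_group] by simp
  moreover have "topological_group (?R \<times>\<times> ?R) ?T"
    by (intro topological_group_DirProd topological_group_real topological_group_discrete R.is_group)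
  ultimately show "\<not> (\<forall>(G :: (real \<times> real) monoid) (T :: (real \<times> real) topology).
              topological_group G T \<longrightarrow> characteristic_subgroup (identity_component G T) G)"
    by blast
qed

end
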